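(* For any positive integer $k$, the signed projective cube $SPC(k)$ is triple-transitive in the following sense. Let $\{x,y,z\}$ and $\{u,v,t\}$ be two triples of distinct vertices of $SPC(k)$. If after a switching (i.e. after replacing, for the pairs having exactly one endpoint in some chosen subset of $\{x,y,z\}$, the set $S^-$ by its complement $S^+$) we have $$(|S^-(x,y)|,|S^-(y,z)|,|S^-(z,x)|)=(|S^-(u,v)|,|S^-(v,t)|,|S^-(t,u)|),$$ then there is an automorphism of $SPC(k)$ mapping $x,y,z$ to $u,v,t$ respectively.
   Context: The signed projective cube $SPC(n)$ is the signed graph with vertex set $\mathbb{Z}_2^n$ in which two vertices at Hamming distance $1$ are joined by a positive edge and two vertices at Hamming distance $n$ are joined by a negative edge. Let $e_1,\dots,e_n$ be the standard basis of $\mathbb{Z}_2^n$, $J=11\cdots1$, and $S_n=\{e_1,\dots,e_n,J\}$. For two vertices $p,q$ there are exactly two subsets of $S_n$ whose sum (in $\mathbb{Z}_2^n$) equals $p+q$, and they are complementary in $S_n$; $S^-(p,q)$ denotes the one containing $J$ and $S^+(p,q)$ the one not containing $J$. Switching at a vertex $p$ interchanges the roles of $S^+(p,q)$ and $S^-(p,q)$ for all $q$. An automorphism of a signed graph is a bijection of its vertex set which, after a switching, maps edges onto edges preserving signs (i.e. an invertible signed-graph homomorphism onto itself, switching allowed). *)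

theory Defs
  imports "HOL-Analysis.Analysis" "HOL-Library.Z2"
begin

text \<open>
  Edges are sets of endpoints. The positive and the negative edge set need not be disjoint: a pair
  of vertices in both of them is joined by two parallel edges of opposite signs.
\<close>

datatype 'a signed_graph =
  Signed_Graph (verts: "'a set") (pos_edges: "'a set set") (neg_edges: "'a set set")

definition in_cut :: "'a set \<Rightarrow> 'a set \<Rightarrow> bool" where
  "in_cut X e \<longleftrightarrow> e \<inter> X \<noteq> {} \<and> e - X \<noteq> {}"

definition switching :: "'a set \<Rightarrow> 'a signed_graph \<Rightarrow> 'a signed_graph" where
  "switching X G = Signed_Graph (verts G)
     ({e \<in> pos_edges G. \<not> in_cut X e} \<union> {e \<in> neg_edges G. in_cut X e})
     ({e \<in> neg_edges G. \<not> in_cut X e} \<union> {e \<in> pos_edges G. in_cut X e})"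

definition signed_automorphism :: "'a signed_graph \<Rightarrow> ('a \<Rightarrow> 'a) \<Rightarrow> bool" where
  "signed_automorphism G f \<longleftrightarrow>
     bij_betw f (verts G) (verts G) \<and>
     (\<exists>X \<subseteq> verts G.
        image f ` pos_edges (switching X G) = pos_edges G \<and>
        image f ` neg_edges (switching X G) = neg_edges G)"

text \<open>
  The vector space \<open>bit ^ 'n\<close> is $\mathbb{Z}_2^n$, where $n$ is \<open>CARD('n)\<close>. Every positive integer
  is the cardinality of some finite type.
\<close>

definition hamming_distance :: "bit ^ 'n \<Rightarrow> bit ^ 'n \<Rightarrow> nat" where
  "hamming_distance p q = card {i. p $ i \<noteq> q $ i}"

definition SPC :: "(bit ^ 'n) signed_graph" where
  "SPC = Signed_Graph UNIV
     {{p, q} | p q. hamming_distance p q = 1}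
     {{p, q} | p q. hamming_distance p q = CARD('n)}"

definition J :: "bit ^ 'n" where
  "J = (\<chi> i. 1)"

definition S :: "(bit ^ 'n) set" where
  "S = insert J (range (\<lambda>i. axis i 1))"

text \<open>
  The two descriptions below determine a set if \<open>CARD('n) \<ge> 2\<close>, see \<open>ex1_S_minus\<close> and
  \<open>ex1_S_plus\<close>. If \<open>CARD('n) = 1\<close>, then \<open>J\<close> coincides with the only basis vector, but the cube
  has only two vertices and hence no triple of distinct ones.
\<close>

definition S_minus :: "bit ^ 'n \<Rightarrow> bit ^ 'n \<Rightarrow> (bit ^ 'n) set" where
  "S_minus p q = (THE A. A \<subseteq> S \<and> J \<in> A \<and> \<Sum>A = p + q)"

definition S_plus :: "bit ^ 'n \<Rightarrow> bit ^ 'n \<Rightarrow> (bit ^ 'n) set" where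
  "S_plus p q = (THE A. A \<subseteq> S \<and> J \<notin> A \<and> \<Sum>A = p + q)"

text \<open>The set playing the role of \<open>S_minus p q\<close> after switching at each vertex of \<open>W\<close>:\<close>

definition S_minus_switched :: "(bit ^ 'n) set \<Rightarrow> bit ^ 'n \<Rightarrow> bit ^ 'n \<Rightarrow> (bit ^ 'n) set" where
  "S_minus_switched W p q = (if (p \<in> W) \<noteq> (q \<in> W) then S_plus p q else S_minus p q)"

lemma J_not_axis:
  assumes "CARD('n) \<ge> 2"
  shows "(J :: bit ^ 'n) \<noteq> axis i 1"
proof
  assume eq: "(J :: bit ^ 'n) = axis i 1"
  have "j = i" for j
    using arg_cong[OF eq, of "\<lambda>v. v $ j"] by (auto simp: J_def axis_def split: if_splits)
  then have "(UNIV :: 'n set) = {i}" by auto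
  then have "CARD('n) = 1" by (metis card_1_singleton_iff One_nat_def)
  with assms show False by simp
qed

lemma sum_axis_component:
  "(\<Sum>((\<lambda>i. axis i (1::bit)) ` I :: (bit ^ 'n) set)) $ j = of_bool (j \<in> I)"
proof -
  have inj: "inj_on (\<lambda>i. axis i (1::bit) :: bit ^ 'n) I"
    by (auto simp: inj_on_def axis_eq_axis)
  have "(\<Sum>((\<lambda>i. axis i (1::bit)) ` I :: (bit ^ 'n) set)) $ j
      = (\<Sum>i\<in>I. (axis i (1::bit) :: bit ^ 'n) $ j)"
    by (simp add: sum.reindex[OF inj] sum_component)
  also have "\<dots> = (\<Sum>i\<in>I. if i = j then 1 else 0)"
    by (intro sum.cong) (auto simp: axis_def)
  also have "\<dots> = of_bool (j \<in> I)" by simp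
  finally show ?thesis .
qed

lemma sum_axis_eq_iff:
  fixes v :: "bit ^ 'n"
  shows "\<Sum>((\<lambda>i. axis i 1) ` I) = v \<longleftrightarrow> I = {i. v $ i = 1}"
proof -
  have "\<Sum>((\<lambda>i. axis i 1) ` I) = v \<longleftrightarrow> (\<forall>j. of_bool (j \<in> I) = v $ j)"
    unfolding vec_eq_iff sum_axis_component by (rule refl)
  also have "\<dots> \<longleftrightarrow> I = {i. v $ i = 1}"
  proof -
    have "of_bool P = b \<longleftrightarrow> (P \<longleftrightarrow> b = 1)" for P and b :: bit
      by (cases b) auto
    then show ?thesis by (simp only: set_eq_iff mem_Collect_eq)
  qed
  finally show ?thesis .
qed

lemma bit_vec_add_eq_iff: "a + b = c \<longleftrightarrow> b = a + c" for a b c :: "bit ^ 'n"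
proof -
  have "x + y = z \<longleftrightarrow> y = x + z" for x y z :: bit
    by (cases x; cases y; cases z) auto
  then show ?thesis by (simp add: vec_eq_iff)
qed

lemma S_plus_set_iff:
  fixes v :: "bit ^ 'n"
  assumes "CARD('n) \<ge> 2"
  shows "A \<subseteq> S \<and> J \<notin> A \<and> \<Sum>A = v \<longleftrightarrow> A = (\<lambda>i. axis i 1) ` {i. v $ i = 1}"
proof
  assume A: "A \<subseteq> S \<and> J \<notin> A \<and> \<Sum>A = v"
  then have "A \<subseteq> range (\<lambda>i. axis i 1)" by (auto simp: S_def)
  then obtain I where I: "A = (\<lambda>i. axis i 1) ` I" by (auto simp: subset_image_iff)
  with A show "A = (\<lambda>i. axis i 1) ` {i. v $ i = 1}" using sum_axis_eq_iff by metis
next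
  assume "A = (\<lambda>i. axis i 1) ` {i. v $ i = 1}"
  then show "A \<subseteq> S \<and> J \<notin> A \<and> \<Sum>A = v"
    using J_not_axis[OF assms] sum_axis_eq_iff[of "{i. v $ i = 1}" v] by (auto simp: S_def)
qed

lemma S_minus_set_iff:
  fixes v :: "bit ^ 'n"
  assumes "CARD('n) \<ge> 2"
  shows "A \<subseteq> S \<and> J \<in> A \<and> \<Sum>A = v \<longleftrightarrow> A = insert J ((\<lambda>i. axis i 1) ` {i. v $ i = 0})"
proof -
  have J: "(J :: bit ^ 'n) \<notin> range (\<lambda>i. axis i 1)" using J_not_axis[OF assms] by auto
  have fin: "finite B" if "B \<subseteq> S" for B :: "(bit ^ 'n) set"
    using that by (rule finite_subset) (simp add: S_def)
  have comp: "(J + v) $ i = 1 \<longleftrightarrow> v $ i = 0" for i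
    by (cases "v $ i") (auto simp: J_def)
  have ins: "\<Sum>(insert J B) = v \<longleftrightarrow> \<Sum>B = J + v" if "J \<notin> B" "B \<subseteq> S"
    for B :: "(bit ^ 'n) set"
    using that by (simp add: sum.insert[OF fin] bit_vec_add_eq_iff)
  have "A \<subseteq> S \<and> J \<in> A \<and> \<Sum>A = v \<longleftrightarrow> J \<in> A \<and> A - {J} \<subseteq> S \<and> J \<notin> A - {J} \<and> \<Sum>(A - {J}) = J + v"
  proof (cases "J \<in> A \<and> A \<subseteq> S")
    case True
    then have "\<Sum>A = v \<longleftrightarrow> \<Sum>(A - {J}) = J + v"
      using ins[of "A - {J}"] by (simp add: insert_absorb Diff_subset[THEN order_trans])
    with True show ?thesis by blast
  next
    case False
    then have "\<not> (J \<in> A \<and> A - {J} \<subseteq> S)" by (auto simp: S_def)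
    with False show ?thesis by blast
  qed
  also have "\<dots> \<longleftrightarrow> J \<in> A \<and> A - {J} = (\<lambda>i. axis i 1) ` {i. v $ i = 0}"
    using S_plus_set_iff[OF assms, of "A - {J}" "J + v"] unfolding comp by blast
  also have "\<dots> \<longleftrightarrow> A = insert J ((\<lambda>i. axis i 1) ` {i. v $ i = 0})"
    using J by blast
  finally show ?thesis .
qed

lemma ex1_S_plus:
  fixes p q :: "bit ^ 'n"
  assumes "CARD('n) \<ge> 2"
  shows "\<exists>!A. A \<subseteq> S \<and> J \<notin> A \<and> \<Sum>A = p + q"
  unfolding S_plus_set_iff[OF assms] by blast

lemma ex1_S_minus:
  fixes p q :: "bit ^ 'n"
  assumes "CARD('n) \<ge> 2"
  shows "\<exists>!A. A \<subseteq> S \<and> J \<in> A \<and> \<Sum>A = p + q"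
  unfolding S_minus_set_iff[OF assms] by blast

lemma S_plus_eq_Compl:
  fixes p q :: "bit ^ 'n"
  assumes "CARD('n) \<ge> 2"
  shows "S_plus p q = S - S_minus p q"
proof -
  let ?e = "\<lambda>i. axis i 1 :: bit ^ 'n"
  let ?I = "\<lambda>a. {i. (p + q) $ i = a}"
  have plus: "S_plus p q = ?e ` ?I 1"
    unfolding S_plus_def S_plus_set_iff[OF assms] by simp
  have minus: "S_minus p q = insert J (?e ` ?I 0)"
    unfolding S_minus_def S_minus_set_iff[OF assms] by simp
  have J: "J \<notin> range ?e" using J_not_axis[OF assms] by auto
  have "inj ?e" by (auto simp: inj_on_def axis_eq_axis)
  then have "range ?e - ?e ` ?I 0 = ?e ` (UNIV - ?I 0)" by (simp add: image_set_diff)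
  moreover have "UNIV - ?I 0 = ?I 1" by (auto simp del: vector_add_component)
  ultimately show ?thesis using J unfolding plus minus S_def by auto
qed

end

theory Submission
  imports Defs "HOL-Combinatorics.Permutations"
begin

text \<open>
  The $n + 1$ elements of \<open>S\<close> add up to $0$ and this is their only linear relation, so every
  permutation \<open>\<pi>\<close> of \<open>S\<close> extends to a linear bijection of $\mathbb{Z}_2^n$. It is a signed
  automorphism: if \<open>\<pi>\<close> sends \<open>e\<^sub>k\<close> to \<open>J\<close>, switch at the vertices with $k$-th coordinate $1$, which
  interchanges the signs of the edges in the directions \<open>e\<^sub>k\<close> and \<open>J\<close> only. The sets
  $S^-(x,y)$, $S^-(y,z)$, $S^-(z,x)$ cover each element of \<open>S\<close> an odd number of times, also after
  a switching. Hence their sizes determine the sizes of all the cells of their Venn diagram, and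
  equal sizes yield a permutation of \<open>S\<close> taking the sets of one triple to those of the other.
\<close>

lemma bit_add_self [simp]: "b + b = (0::bit)"
  by (cases b) auto

lemma bit_vec_add_self [simp]: "v + v = (0 :: bit ^ 'n)"
  by (simp add: vec_eq_iff)

lemma bit_vec_add_self_left [simp]: "a + (a + b) = (b :: bit ^ 'n)"
  by (metis add.assoc add_0 bit_vec_add_self)

text \<open>In dimension 1 the single bit determines the vertex, so three distinct vertices cannot
  exist. This excludes the case in which \<open>J\<close> is a basis vector.\<close>

lemma distinct3_card_ge_2:
  fixes x y z :: "bit ^ 'n"
  assumes "distinct [x, y, z]"
  shows "CARD('n) \<ge> 2"
proof (rule ccontr)
  assume "\<not> CARD('n) \<ge> 2"
  moreover have "CARD('n) > 0" by simp
  ultimately have "CARD('n) = 1" by linarith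
  then obtain i :: 'n where i: "UNIV = {i}" by (rule card_1_singletonE)
  then have "a = b \<longleftrightarrow> a $ i = b $ i" for a b :: "bit ^ 'n"
    by (metis (full_types) UNIV_I singletonD vec_eq_iff)
  with assms show False
    by (cases "x $ i"; cases "y $ i"; cases "z $ i") auto
qed

section \<open>Automorphisms from permutations of the generators\<close>

lemma finite_S [simp]: "finite S"
  by (simp add: S_def)

lemma axis_in_S [simp]: "axis i 1 \<in> S"
  by (simp add: S_def)

lemma J_in_S [simp]: "J \<in> S"
  by (simp add: S_def)

lemma sum_axes: "(\<Sum>i\<in>UNIV. axis i (1::bit)) = (J :: bit ^ 'n)"
  by (simp add: vec_eq_iff J_def axis_def)

lemma sum_over_S:
  assumes "CARD('n) \<ge> 2"
  shows "(\<Sum>s\<in>(S :: (bit ^ 'n) set). g s) = g J + (\<Sum>i\<in>UNIV. g (axis i 1))"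
proof -
  have "J \<notin> range (\<lambda>i. axis i 1 :: bit ^ 'n)"
    using J_not_axis[OF assms] by auto
  moreover have "inj (\<lambda>i. axis i 1 :: bit ^ 'n)"
    by (auto simp: inj_on_def axis_eq_axis)
  ultimately show ?thesis
    by (simp add: S_def sum.reindex)
qed

definition linear_extension :: "(bit ^ 'n \<Rightarrow> bit ^ 'n) \<Rightarrow> bit ^ 'n \<Rightarrow> bit ^ 'n" where
  "linear_extension \<pi> v = (\<Sum>i\<in>UNIV. v $ i *s \<pi> (axis i 1))"

lemma linear_extension_0 [simp]: "linear_extension \<pi> 0 = 0"
  by (simp add: linear_extension_def)

lemma linear_extension_add:
  "linear_extension \<pi> (v + w) = linear_extension \<pi> v + linear_extension \<pi> w"
  by (simp add: linear_extension_def sum.distrib del: add_bit_eq_xor)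

lemma linear_extension_scale: "linear_extension \<pi> (c *s v) = c *s linear_extension \<pi> v"
  by (cases c) auto

lemma linear_extension_sum:
  "linear_extension \<pi> (\<Sum>a\<in>A. g a) = (\<Sum>a\<in>A. linear_extension \<pi> (g a))"
  by (induction A rule: infinite_finite_induct) (auto simp: linear_extension_add)

lemma linear_extension_axis: "linear_extension \<pi> (axis i 1) = \<pi> (axis i 1)"
proof -
  have "linear_extension \<pi> (axis i 1) = (\<Sum>j\<in>UNIV. if j = i then \<pi> (axis j 1) else 0)"
    unfolding linear_extension_def by (intro sum.cong) (auto simp: axis_def)
  then show ?thesis by simp
qed

text \<open>Only \<open>s = J\<close> needs an argument. The elements of \<open>S\<close> add up to
  0 and \<pi> merely reorders them, so \<open>\<pi> J\<close> equals the sum of the images of the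
  basis vectors, which is the extension at \<open>J\<close>.\<close>

lemma linear_extension_S:
  fixes s :: "bit ^ 'n"
  assumes n: "CARD('n) \<ge> 2" and \<pi>: "\<pi> permutes S" and s: "s \<in> S"
  shows "linear_extension \<pi> s = \<pi> s"
proof (cases "s = J")
  case True
  have "\<pi> J + linear_extension \<pi> J = (\<Sum>s\<in>S. \<pi> s)"
    unfolding sum_over_S[OF n]
    by (simp flip: sum_axes add: linear_extension_sum linear_extension_axis)
  also have "\<dots> = (\<Sum>s\<in>S. s)"
    using sum.permute[OF \<pi>, of "\<lambda>s. s"] by (simp add: o_def)
  also have "\<dots> = 0"
    by (simp add: sum_over_S[OF n] sum_axes)
  \<comment> \<open>In characteristic 2 a vanishing sum of two vectors means that they are
    equal.\<close>
  finally show ?thesis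
    using True by (metis bit_vec_add_eq_iff add_0_right)
next
  case False
  with s show ?thesis by (auto simp: S_def linear_extension_axis)
qed

text \<open>It suffices to look at basis vectors. Since \<open>\<pi> (axis i 1)\<close> may be
  \<open>J\<close>, evaluating the second extension there relies on
  \<open>linear_extension_S\<close>.\<close>

lemma linear_extension_inverse:
  fixes v :: "bit ^ 'n"
  assumes n: "CARD('n) \<ge> 2" and \<pi>: "\<pi> permutes S"
  shows "linear_extension (inv \<pi>) (linear_extension \<pi> v) = v"
proof -
  have "linear_extension (inv \<pi>) (\<pi> (axis i 1)) = axis i 1" for i
    using linear_extension_S[OF n permutes_inv[OF \<pi>]] \<pi>
    by (simp add: permutes_in_image permutes_inverses)
  then have "linear_extension (inv \<pi>) (linear_extension \<pi> v) = (\<Sum>i\<in>UNIV. v $ i *s axis i 1)"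
    unfolding linear_extension_def[of \<pi>]
    by (simp add: linear_extension_sum linear_extension_scale)
  then show ?thesis by (simp add: basis_expansion)
qed

lemma linear_extension_Sum:
  fixes A :: "(bit ^ 'n) set"
  assumes "CARD('n) \<ge> 2" and \<pi>: "\<pi> permutes S" and "A \<subseteq> S"
  shows "linear_extension \<pi> (\<Sum>A) = \<Sum>(\<pi> ` A)"
proof -
  have "linear_extension \<pi> (\<Sum>A) = (\<Sum>s\<in>A. \<pi> s)"
    unfolding linear_extension_sum using assms by (intro sum.cong) (auto intro: linear_extension_S)
  also have "\<dots> = \<Sum>(\<pi> ` A)"
    using permutes_inj_on[OF \<pi>, of A] by (simp add: sum.reindex)
  finally show ?thesis .
qed

section \<open>Edges of the cube sorted by direction\<close>

lemma hamming_distance_1_iff: "hamming_distance p q = 1 \<longleftrightarrow> (\<exists>i. q = p + axis i 1)"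
proof
  assume "hamming_distance p q = 1"
  then obtain i where "{i. p $ i \<noteq> q $ i} = {i}"
    unfolding hamming_distance_def by (rule card_1_singletonE)
  then have i: "p $ j \<noteq> q $ j \<longleftrightarrow> j = i" for j by blast
  have "q $ j = (p + axis i 1) $ j" for j
    using i[of j] by (cases "p $ j"; cases "q $ j") (auto simp: axis_def)
  then show "\<exists>i. q = p + axis i 1" by (auto simp: vec_eq_iff)
next
  assume "\<exists>i. q = p + axis i 1"
  then obtain i where "q = p + axis i 1" by blast
  then have "{i. p $ i \<noteq> q $ i} = {i}" by (auto simp: axis_def)
  then show "hamming_distance p q = 1" by (simp add: hamming_distance_def)
qed

lemma hamming_distance_CARD_iff:
  fixes p q :: "bit ^ 'n"
  shows "hamming_distance p q = CARD('n) \<longleftrightarrow> q = p + J"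
proof -
  have bits: "b = a + 1 \<longleftrightarrow> a \<noteq> b" for a b :: bit
    by (cases a; cases b) auto
  have "hamming_distance p q = CARD('n) \<longleftrightarrow> {i. p $ i \<noteq> q $ i} = UNIV"
  proof
    assume "hamming_distance p q = CARD('n)"
    then show "{i. p $ i \<noteq> q $ i} = UNIV"
      unfolding hamming_distance_def by (intro card_subset_eq) simp_all
  next
    assume "{i. p $ i \<noteq> q $ i} = UNIV"
    then show "hamming_distance p q = CARD('n)"
      by (simp only: hamming_distance_def)
  qed
  also have "\<dots> \<longleftrightarrow> (\<forall>i. p $ i \<noteq> q $ i)" by auto
  also have "\<dots> \<longleftrightarrow> q = p + J"
    by (simp only: vec_eq_iff vector_add_component J_def vec_lambda_beta bits)
  finally show ?thesis .
qed

definition edges_in_directions :: "(bit ^ 'n) set \<Rightarrow> (bit ^ 'n) set set" where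
  "edges_in_directions A = {{p, p + s} | p s. s \<in> A}"

lemma edges_in_directions_Un:
  "edges_in_directions (A \<union> B) = edges_in_directions A \<union> edges_in_directions B"
  unfolding edges_in_directions_def by blast

lemma edges_in_directions_filter:
  assumes "\<And>p s. s \<in> A \<Longrightarrow> P {p, p + s} \<longleftrightarrow> Q s"
  shows "{e \<in> edges_in_directions A. P e} = edges_in_directions {s \<in> A. Q s}"
proof (intro equalityI subsetI)
  fix e assume "e \<in> {e \<in> edges_in_directions A. P e}"
  then obtain p s where "s \<in> A" "e = {p, p + s}" "P {p, p + s}"
    unfolding edges_in_directions_def by blast
  with assms show "e \<in> edges_in_directions {s \<in> A. Q s}"
    unfolding edges_in_directions_def by blast
next
  fix e assume "e \<in> edges_in_directions {s \<in> A. Q s}"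
  then obtain p s where "s \<in> A" "Q s" "e = {p, p + s}"
    unfolding edges_in_directions_def by blast
  with assms show "e \<in> {e \<in> edges_in_directions A. P e}"
    unfolding edges_in_directions_def by blast
qed

lemma verts_SPC: "verts SPC = UNIV"
  by (simp add: SPC_def)

lemma pos_edges_SPC:
  assumes "CARD('n) \<ge> 2"
  shows "pos_edges SPC = edges_in_directions (S - {J :: bit ^ 'n})"
proof -
  have "S - {J :: bit ^ 'n} = range (\<lambda>i. axis i 1)"
    unfolding S_def using J_not_axis[OF assms, symmetric] by auto
  then show ?thesis
    by (auto simp: SPC_def edges_in_directions_def hamming_distance_1_iff simp flip: One_nat_def)
qed

lemma neg_edges_SPC: "neg_edges SPC = edges_in_directions {J}"
  by (auto simp: SPC_def edges_in_directions_def hamming_distance_CARD_iff)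

lemma ex_switching_set:
  fixes r :: "bit ^ 'n"
  assumes n: "CARD('n) \<ge> 2" and "r \<in> S"
  shows "\<exists>X. \<forall>p. \<forall>s\<in>S. in_cut X {p, p + s} \<longleftrightarrow> (s = J) \<noteq> (s = r)"
proof (cases "r = J")
  case True
  then show ?thesis by (intro exI[of _ "{}"]) (simp add: in_cut_def)
next
  case False
  with \<open>r \<in> S\<close> obtain k where k: "r = axis k 1" by (auto simp: S_def)
  have cut: "in_cut {v. v $ k = 1} {p, p + s} \<longleftrightarrow> s $ k = 1" for p s :: "bit ^ 'n"
    by (cases "p $ k"; cases "s $ k") (auto simp: in_cut_def)
  have "s $ k = 1 \<longleftrightarrow> (s = J) \<noteq> (s = r)" if "s \<in> S" for s
    using that J_not_axis[OF n] J_not_axis[OF n, symmetric] unfolding k S_def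
    by (auto simp: J_def axis_def axis_eq_axis) (auto simp: axis_def split: if_splits)
  with cut show ?thesis by blast
qed

lemma image_edges_in_directions:
  assumes "surj f" and "\<And>p s. s \<in> A \<Longrightarrow> f (p + s) = f p + \<pi> s"
  shows "image f ` edges_in_directions A = edges_in_directions (\<pi> ` A)"
proof (intro equalityI subsetI)
  fix e assume "e \<in> image f ` edges_in_directions A"
  then obtain p s where "s \<in> A" "e = f ` {p, p + s}"
    unfolding edges_in_directions_def by blast
  then show "e \<in> edges_in_directions (\<pi> ` A)"
    using assms(2) unfolding edges_in_directions_def by auto
next
  fix e assume "e \<in> edges_in_directions (\<pi> ` A)"
  then obtain q s where e: "s \<in> A" "e = {q, q + \<pi> s}"
    unfolding edges_in_directions_def by blast
  obtain p where "q = f p" using \<open>surj f\<close> by (rule surjE)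
  with e have "e = f ` {p, p + s}" using assms(2) by simp
  with e(1) show "e \<in> image f ` edges_in_directions A"
    unfolding edges_in_directions_def by blast
qed

text \<open>The translations by \<open>a\<close> and \<open>b\<close> preserve directions, so only
  \<pi> affects the signs. They are there to let the map send one prescribed vertex \<open>a\<close>
  to another, \<open>b\<close>.\<close>

lemma signed_automorphism_SPC_permutation:
  fixes \<pi> :: "bit ^ 'n \<Rightarrow> bit ^ 'n"
  assumes n: "CARD('n) \<ge> 2" and \<pi>: "\<pi> permutes S"
  shows "signed_automorphism SPC (\<lambda>v. linear_extension \<pi> (v + a) + b)"
    (is "signed_automorphism SPC ?f")
proof -
  have "inj ?f"
    by (rule injI) (metis add_right_cancel linear_extension_inverse[OF n \<pi>])
  moreover have "linear_extension \<pi> (linear_extension (inv \<pi>) w) = w" for w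
    using linear_extension_inverse[OF n permutes_inv[OF \<pi>]] by (simp add: permutes_inv_inv[OF \<pi>])
  \<comment> \<open>Translations are their own inverses, which yields the explicit right
    inverse.\<close>
  then have "surj ?f"
    by (intro surjI[of ?f "\<lambda>w. linear_extension (inv \<pi>) (w + b) + a"]) (simp add: add.assoc)
  ultimately have bij: "bij ?f"
    by (simp add: bij_def)
  have shift: "?f (p + s) = ?f p + \<pi> s" if "s \<in> S" for p s
    using linear_extension_S[OF n \<pi> that] by (simp add: linear_extension_add algebra_simps)
  have image: "image ?f ` edges_in_directions A = edges_in_directions (\<pi> ` A)" if "A \<subseteq> S" for A
    using that by (intro image_edges_in_directions bij_is_surj[OF bij] shift) auto
  \<comment> \<open>The direction that \<pi> turns into \<open>J\<close>; the switching has to make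
    it the only negative one.\<close>
  define r where "r = inv \<pi> J"
  have r: "r \<in> S" "\<pi> r = J"
    using \<pi> permutes_in_image[OF permutes_inv[OF \<pi>]] by (simp_all add: r_def permutes_inverses)
  then obtain X where X: "in_cut X {p, p + s} \<longleftrightarrow> (s = J) \<noteq> (s = r)" if "s \<in> S" for p s
    using ex_switching_set[OF n] by metis
  have cut: "{e \<in> edges_in_directions A. in_cut X e}
        = edges_in_directions {s \<in> A. (s = J) \<noteq> (s = r)}"
    and uncut: "{e \<in> edges_in_directions A. \<not> in_cut X e}
        = edges_in_directions {s \<in> A. (s = J) = (s = r)}" if "A \<subseteq> S" for A
    by (rule edges_in_directions_filter; use X that in blast)+
  \<comment> \<open>The positive and the negative directions after switching. Both identities also
    cover \<open>r = J\<close>, where nothing is switched.\<close>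
  have "{s \<in> S - {J}. (s = J) = (s = r)} \<union> {s \<in> {J}. (s = J) \<noteq> (s = r)} = S - {r}"
    "{s \<in> {J}. (s = J) = (s = r)} \<union> {s \<in> S - {J}. (s = J) \<noteq> (s = r)} = {r}"
    using r(1) J_in_S by blast+
  then have "pos_edges (switching X SPC) = edges_in_directions (S - {r})"
    "neg_edges (switching X SPC) = edges_in_directions {r}"
    unfolding switching_def signed_graph.sel pos_edges_SPC[OF n] neg_edges_SPC
    by (simp_all add: cut uncut flip: edges_in_directions_Un)
  moreover have "\<pi> ` (S - {r}) = S - {J}"
    using \<pi> r by (simp add: image_set_diff permutes_inj permutes_image)
  ultimately have "image ?f ` pos_edges (switching X SPC) = pos_edges SPC"
    "image ?f ` neg_edges (switching X SPC) = neg_edges SPC"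
    using r by (simp_all add: image pos_edges_SPC[OF n] neg_edges_SPC)
  with bij show ?thesis
    unfolding signed_automorphism_def verts_SPC by blast
qed

section \<open>Triples of sets covering every element an odd number of times\<close>

text \<open>The nested equivalence holds exactly when one or all three of the memberships
  hold.\<close>

definition odd_cover :: "'a set \<Rightarrow> 'a set \<Rightarrow> 'a set \<Rightarrow> 'a set \<Rightarrow> bool" where
  "odd_cover U A B C \<longleftrightarrow> A \<subseteq> U \<and> B \<subseteq> U \<and> C \<subseteq> U \<and> (\<forall>s\<in>U. (s \<in> A \<longleftrightarrow> s \<in> B) \<longleftrightarrow> s \<in> C)"

text \<open>Cells of the Venn diagram are indexed by triples of truth values. Odd covering empties
  the four cells with an even number of memberships, which leaves four unknown sizes and four
  equations.\<close>

lemma odd_cover_cards: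
  assumes "finite U" and cover: "odd_cover U A B C"
  defines "N \<equiv> \<lambda>c. card {s \<in> U. (s \<in> A, s \<in> B, s \<in> C) = c}"
  shows "card A = N (True, True, True) + N (True, False, False)"
    and "card B = N (True, True, True) + N (False, True, False)"
    and "card C = N (True, True, True) + N (False, False, True)"
    and "card U = N (True, True, True) + N (True, False, False)
      + N (False, True, False) + N (False, False, True)"
    and "N (True, True, False) = 0" "N (True, False, True) = 0" "N (False, True, True) = 0"
      "N (False, False, False) = 0"
proof -
  let ?cell = "\<lambda>c. {s \<in> U. (s \<in> A, s \<in> B, s \<in> C) = c}"
  have disjoint: "card (?cell c \<union> ?cell d) = N c + N d" if "c \<noteq> d" for c d
    unfolding N_def using \<open>finite U\<close> that by (intro card_Un_disjoint) auto
  have sets: "A = ?cell (True, True, True) \<union> ?cell (True, False, False)"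
    "B = ?cell (True, True, True) \<union> ?cell (False, True, False)"
    "C = ?cell (True, True, True) \<union> ?cell (False, False, True)"
    "U - A = ?cell (False, True, False) \<union> ?cell (False, False, True)"
    using cover unfolding odd_cover_def by auto
  show A: "card A = N (True, True, True) + N (True, False, False)"
    by (subst sets(1), subst disjoint) simp_all
  show "card B = N (True, True, True) + N (False, True, False)"
    by (subst sets(2), subst disjoint) simp_all
  show "card C = N (True, True, True) + N (False, False, True)"
    by (subst sets(3), subst disjoint) simp_all
  have "card (U - A) = N (False, True, False) + N (False, False, True)"
    by (subst sets(4), subst disjoint) simp_all
  moreover have "card U = card A + card (U - A)"
    using assms(1) cover unfolding odd_cover_def
    by (metis card_Diff_subset card_mono finite_subset le_add_diff_inverse)
  ultimately show "card U = N (True, True, True) + N (True, False, False)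
      + N (False, True, False) + N (False, False, True)"
    using A by simp
  have "?cell (True, True, False) = {}" "?cell (True, False, True) = {}"
    "?cell (False, True, True) = {}" "?cell (False, False, False) = {}"
    using cover unfolding odd_cover_def by auto
  then show "N (True, True, False) = 0" "N (True, False, True) = 0" "N (False, True, True) = 0"
      "N (False, False, False) = 0"
    unfolding N_def by (simp_all only: card.empty)
qed

text \<open>Colour each element by its three memberships. Both colourings use every colour equally
  often, so some permutation of \<open>U\<close> carries one to the other.\<close>

lemma odd_cover_ex_permutation:
  assumes fin: "finite U" and cover: "odd_cover U A B C" "odd_cover U A' B' C'"
    and card: "card A = card A'" "card B = card B'" "card C = card C'"
  shows "\<exists>\<pi>. \<pi> permutes U \<and> \<pi> ` A = A' \<and> \<pi> ` B = B' \<and> \<pi> ` C = C'"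
proof -
  let ?g = "\<lambda>s. (s \<in> A, s \<in> B, s \<in> C)" and ?g' = "\<lambda>s. (s \<in> A', s \<in> B', s \<in> C')"
  let ?N = "\<lambda>g c. card {s \<in> U. g s = c}"
  note cells = odd_cover_cards[OF fin cover(1)] and cells' = odd_cover_cards[OF fin cover(2)]
  have full: "?N ?g (True, True, True) = ?N ?g' (True, True, True)"
    and single: "?N ?g (True, False, False) = ?N ?g' (True, False, False)"
      "?N ?g (False, True, False) = ?N ?g' (False, True, False)"
      "?N ?g (False, False, True) = ?N ?g' (False, False, True)"
    \<comment> \<open>The three cardinalities add up to \<open>card U\<close> plus twice the size of
      the triple intersection. This fixes that size, and subtraction gives the others.\<close>
    using cells(1-4) cells'(1-4) card by linarith+
  have same: "?N ?g c = ?N ?g' c" for c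
  proof -
    obtain c1 c2 c3 where c: "c = (c1, c2, c3)" by (cases c)
    show ?thesis
      unfolding c
      by (cases c1; cases c2; cases c3) (simp_all only: full single cells(5-8) cells'(5-8))
  qed
  \<comment> \<open>The multiplicity of a colour in the image multiset is its cell size, so equal
    cell sizes give equal multisets.\<close>
  have count: "count (image_mset g (mset_set U)) c = ?N g c" for g :: "'a \<Rightarrow> bool \<times> bool \<times> bool" and c
  proof -
    have "count (image_mset g (mset_set U)) c = (\<Sum>s | s \<in> U \<and> c = g s. count (mset_set U) s)"
      using fin by (simp only: count_image_mset' finite_set_mset_mset_set)
    also have "\<dots> = (\<Sum>s | s \<in> U \<and> c = g s. 1)"
      using fin by (intro sum.cong) auto
    also have "\<dots> = ?N g c"
      by (simp only: card_eq_sum eq_commute[of c])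
    finally show ?thesis .
  qed
  have "image_mset ?g (mset_set U) = image_mset ?g' (mset_set U)"
    unfolding multiset_eq_iff count using same by blast
  then obtain \<pi> where \<pi>: "\<pi> permutes U" and colour: "\<forall>s\<in>U. ?g s = ?g' (\<pi> s)"
    by (rule image_mset_eq_implies_permutes[OF fin])
  have image: "\<pi> ` D = D'" if "D \<subseteq> U" "D' \<subseteq> U" "\<And>s. s \<in> U \<Longrightarrow> s \<in> D \<longleftrightarrow> \<pi> s \<in> D'" for D D'
  proof
    show "\<pi> ` D \<subseteq> D'" using that by auto
    show "D' \<subseteq> \<pi> ` D"
    proof
      fix d assume d: "d \<in> D'"
      with that(2) permutes_image[OF \<pi>] obtain s where "s \<in> U" "d = \<pi> s" by blast
      with d that(3) show "d \<in> \<pi> ` D" by blast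
    qed
  qed
  have "\<pi> ` A = A'" "\<pi> ` B = B'" "\<pi> ` C = C'"
    by (rule image; use cover colour in \<open>simp add: odd_cover_def\<close>)+
  with \<pi> show ?thesis by blast
qed

section \<open>The minus sets of a triple of vertices\<close>

lemma S_minus_eq:
  fixes p q :: "bit ^ 'n"
  assumes "CARD('n) \<ge> 2"
  shows "S_minus p q = insert J ((\<lambda>i. axis i 1) ` {i. p $ i = q $ i})"
proof -
  have "a + b = 0 \<longleftrightarrow> a = b" for a b :: bit by (cases a; cases b) auto
  then show ?thesis
    unfolding S_minus_def S_minus_set_iff[OF assms] by simp
qed

lemma Sum_S_minus_switched:
  fixes p q :: "bit ^ 'n"
  assumes "CARD('n) \<ge> 2"
  shows "\<Sum>(S_minus_switched W p q) = p + q"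
  using theI'[OF ex1_S_plus[OF assms, of p q]] theI'[OF ex1_S_minus[OF assms, of p q]]
  by (simp add: S_minus_switched_def S_plus_def S_minus_def)

text \<open>\<open>J\<close> lies in all three unswitched sets, and a basis vector lies in one
  exactly if the two vertices agree in that coordinate; among three bits, one or three pairs agree.
  Switching complements zero or two of the sets, so parity is kept.\<close>

lemma odd_cover_S_minus_switched:
  fixes x y z :: "bit ^ 'n"
  assumes n: "CARD('n) \<ge> 2"
  shows "odd_cover S (S_minus_switched W x y) (S_minus_switched W y z) (S_minus_switched W z x)"
proof -
  have sub: "S_minus p q \<subseteq> S" for p q :: "bit ^ 'n"
    unfolding S_minus_eq[OF n] by auto
  have axis: "axis i 1 \<in> S_minus p q \<longleftrightarrow> p $ i = q $ i" for i and p q :: "bit ^ 'n"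
    using J_not_axis[OF n, of i] unfolding S_minus_eq[OF n] by (auto simp: axis_eq_axis)
  have J: "J \<in> S_minus p q" for p q :: "bit ^ 'n"
    unfolding S_minus_eq[OF n] by simp
  have bits: "((a = b) = (b = c)) = (c = a)" for a b c :: bit
    by (cases a; cases b; cases c) auto
  have odd: "((s \<in> S_minus x y) = (s \<in> S_minus y z)) = (s \<in> S_minus z x)" if "s \<in> S" for s
    using that unfolding S_def by (elim insertE rangeE) (simp_all add: J axis bits)
  have mem: "s \<in> S_minus_switched W p q \<longleftrightarrow> ((p \<in> W) = (q \<in> W)) = (s \<in> S_minus p q)"
    if "s \<in> S" for s and p q :: "bit ^ 'n"
    using that by (auto simp: S_minus_switched_def S_plus_eq_Compl[OF n])
  have "S_minus_switched W p q \<subseteq> S" for p q :: "bit ^ 'n"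
    using sub by (auto simp: S_minus_switched_def S_plus_eq_Compl[OF n])
  with odd show ?thesis
    unfolding odd_cover_def by (auto simp: mem)
qed

theorem theorem4:
  fixes x y z u v t :: "bit ^ 'n"
  assumes "distinct [x, y, z]" and "distinct [u, v, t]"
    and "\<exists>W \<subseteq> {x, y, z}.
      (card (S_minus_switched W x y), card (S_minus_switched W y z), card (S_minus_switched W z x))
      = (card (S_minus u v), card (S_minus v t), card (S_minus t u))"
  shows "\<exists>f. signed_automorphism SPC f \<and> f x = u \<and> f y = v \<and> f z = t"
proof -
  have n: "CARD('n) \<ge> 2" using assms(1) by (rule distinct3_card_ge_2)
  obtain W where W: "card (S_minus_switched W x y) = card (S_minus u v)"
    "card (S_minus_switched W y z) = card (S_minus v t)"
    "card (S_minus_switched W z x) = card (S_minus t u)"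
    using assms(3) by auto
  \<comment> \<open>The triple \<open>u\<close>, \<open>v\<close>, \<open>t\<close> becomes the case
    of an empty switching set, so the same lemmas serve both triples.\<close>
  have unswitched: "S_minus = S_minus_switched {}"
    by (simp add: fun_eq_iff S_minus_switched_def)
  obtain \<pi> where \<pi>: "\<pi> permutes S"
    and images: "\<pi> ` S_minus_switched W x y = S_minus u v"
      "\<pi> ` S_minus_switched W z x = S_minus t u"
    using odd_cover_ex_permutation[OF finite_S odd_cover_S_minus_switched[OF n, of W x y z]
        odd_cover_S_minus_switched[OF n, of "{}" u v t]] W
    unfolding unswitched by blast
  \<comment> \<open>Switched or not, the sets sum to the sum of their two vertices, so matching sets
    makes the linear map match vertex differences.\<close>
  have L: "linear_extension \<pi> (p + q) = p' + q'"
    if "\<pi> ` S_minus_switched W p q = S_minus p' q'" "S_minus_switched W p q \<subseteq> S" for p q p' q'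
    using linear_extension_Sum[OF n \<pi> that(2)] that(1)
    by (simp add: unswitched Sum_S_minus_switched[OF n])
  have "S_minus_switched W x y \<subseteq> S" "S_minus_switched W z x \<subseteq> S"
    using odd_cover_S_minus_switched[OF n] unfolding odd_cover_def by blast+
  then have "linear_extension \<pi> (x + y) = u + v" "linear_extension \<pi> (z + x) = t + u"
    using L images by blast+
  then have "linear_extension \<pi> (y + x) + u = v" "linear_extension \<pi> (z + x) + u = t"
    by (simp_all add: ac_simps)
  then show ?thesis
    using signed_automorphism_SPC_permutation[OF n \<pi>, of x u]
    \<comment> \<open>Translating \<open>x\<close> to 0 and 0 to \<open>u\<close> around the linear
      map sends \<open>x\<close> to \<open>u\<close>; the two preceding equations handle
      \<open>y\<close> and \<open>z\<close>.\<close>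
    by (intro exI[of _ "\<lambda>w. linear_extension \<pi> (w + x) + u"]) simp
qed

end
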